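(* Let $f=f_1\cdots f_d\in\mathbb{C}[x_1,\dots,x_n]$ be a product of linear forms cutting out a central, reduced hyperplane arrangement $\mathscr{A}$ in $X=\mathbb{C}^n$, and let $\boldsymbol\lambda=(\lambda_1,\dots,\lambda_d)\in\mathbb{C}^d$ be weights such that for every edge $E$ of $\mathscr{A}$ $$\sum_{\{1\le k\le d\,\mid\,E\subseteq\{f_k=0\}\}}\lambda_k\notin\mathbb{Z}_{\ge\min\{2,\operatorname{rank}(E)\}}.$$ Then $\mathscr{D}_Xf^{-\mathbf{1}+\boldsymbol\lambda}=\mathscr{O}_X(\star f^{\boldsymbol\lambda})$.
   Context: The hyperplanes $\{f_k=0\}$ ($d \geq 1$) are pairwise distinct and pass through the origin. An edge is an intersection of one or more hyperplanes of $\mathscr{A}$; its rank is its codimension in $X$. $X=\mathbb{C}^n$ is a complex manifold with sheaf of holomorphic functions $\mathscr{O}_X$, and $\mathscr{D}_X$ is the sheaf of $\mathbb{C}$-linear analytic differential operators. For $\boldsymbol\mu\in\mathbb{C}^d$, $f^{\boldsymbol\mu}=f_1^{\mu_1}\cdots f_d^{\mu_d}$ is a formal symbol; $\mathscr{D}_X$ acts on $\mathscr{O}_X[1/f]\,f^{\boldsymbol\lambda}$ via the chain and product rules, i.e. a derivation $\delta$ acts by $\delta(g f^{\boldsymbol\lambda})=\big(\delta(g)+g\sum_k\lambda_k\delta(f_k)/f_k\big)f^{\boldsymbol\lambda}$, and for $\mathbf{p}\in\mathbb{Z}^d$, $f^{\boldsymbol\lambda-\mathbf{p}}=f_1^{-p_1}\cdots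 f_d^{-p_d}\cdot f^{\boldsymbol\lambda}$. Then $\mathscr{O}_X(\star f^{\boldsymbol\lambda})=\bigcup_{\mathbf{p}\in\mathbb{N}^d}\mathscr{D}_Xf^{\boldsymbol\lambda-\mathbf{p}}$ $(=\mathscr{O}_X[1/f]f^{\boldsymbol\lambda})$, and $\mathscr{D}_Xf^{-\mathbf{1}+\boldsymbol\lambda}$ is the cyclic submodule generated by $f^{-1}f^{\boldsymbol\lambda}$, where $\mathbf{1}=(1,\dots,1)$. *)

theory Defs
  imports "HOL-Analysis.Analysis"
begin

section \<open>Hyperplane arrangements\<close>

definition hyperplane :: "(nat \<Rightarrow> complex ^ 'n \<Rightarrow> complex) \<Rightarrow> nat \<Rightarrow> (complex ^ 'n) set" where
  "hyperplane f k = {x. f k x = 0}"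

text \<open>Distinctness of the hyperplanes says that \<open>f\<^sub>1 \<cdots> f\<^sub>d\<close> is reduced;
  linearity of the forms says that the arrangement is central.\<close>

definition reduced_central_arrangement :: "nat \<Rightarrow> (nat \<Rightarrow> complex ^ 'n \<Rightarrow> complex) \<Rightarrow> bool" where
  "reduced_central_arrangement d f \<longleftrightarrow>
     d \<ge> 1 \<and>
     (\<forall>k\<in>{1..d}. Vector_Spaces.linear (*s) (*) (f k) \<and> (\<exists>x. f k x \<noteq> 0)) \<and>
     inj_on (hyperplane f) {1..d}"

definition edges :: "nat \<Rightarrow> (nat \<Rightarrow> complex ^ 'n \<Rightarrow> complex) \<Rightarrow> (complex ^ 'n) set set" where
  "edges d f = {\<Inter>k\<in>I. hyperplane f k | I. I \<subseteq> {1..d} \<and> I \<noteq> {}}"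

text \<open>\<^const>\<open>vec.dim\<close> is the dimension over the complex numbers.\<close>

definition edge_rank :: "(complex ^ 'n) set \<Rightarrow> nat" where
  "edge_rank E = CARD('n) - vec.dim E"

definition divisor :: "nat \<Rightarrow> (nat \<Rightarrow> complex ^ 'n \<Rightarrow> complex) \<Rightarrow> (complex ^ 'n) set" where
  "divisor d f = {x. (\<Prod>k=1..d. f k x) = 0}"

section \<open>Holomorphic functions and differential operators\<close>

definition mv_holomorphic_on :: "(complex ^ 'n \<Rightarrow> complex) \<Rightarrow> (complex ^ 'n) set \<Rightarrow> bool" where
  "mv_holomorphic_on g U \<longleftrightarrow>
     (\<forall>x\<in>U. \<exists>D. (g has_derivative D) (at x) \<and> (\<forall>c v. D (c *s v) = c * D v))"

definition partial :: "'n \<Rightarrow> (complex ^ 'n \<Rightarrow> complex) \<Rightarrow> complex ^ 'n \<Rightarrow> complex" where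
  "partial i g x = deriv (\<lambda>t. g (x + t *s axis i 1)) 0"

text \<open>A derivation of the sheaf of holomorphic functions on an open subset of \<open>\<complex>\<^sup>n\<close> is a
  vector field \<open>\<Sum>\<^sub>i b\<^sub>i \<partial>/\<partial>x\<^sub>i\<close> with holomorphic coefficients.\<close>

definition derivation ::
  "(complex ^ 'n \<Rightarrow> complex ^ 'n) \<Rightarrow> (complex ^ 'n \<Rightarrow> complex) \<Rightarrow> complex ^ 'n \<Rightarrow> complex" where
  "derivation b g x = (\<Sum>i\<in>UNIV. b x $ i * partial i g x)"

type_synonym 'n operator = "(complex ^ 'n \<Rightarrow> complex) \<Rightarrow> complex ^ 'n \<Rightarrow> complex"

text \<open>The operators generated by functions and derivations that are holomorphic on \<open>U\<close>.
  All of them are local: on an open subset of \<open>U\<close>, the result depends only on the values of the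
  argument on that subset. The sheaf \<open>\<D>\<^sub>X\<close> is the one associated with the presheaf
  \<open>U \<mapsto> diff_ops U\<close>.\<close>

inductive_set diff_ops :: "(complex ^ 'n) set \<Rightarrow> 'n operator set"
  for U :: "(complex ^ 'n) set" where
  mult: "mv_holomorphic_on a U \<Longrightarrow> (\<lambda>g x. a x * g x) \<in> diff_ops U"
| deriv: "(\<And>i. mv_holomorphic_on (\<lambda>x. b x $ i) U) \<Longrightarrow> derivation b \<in> diff_ops U"
| add: "P \<in> diff_ops U \<Longrightarrow> P' \<in> diff_ops U \<Longrightarrow> (\<lambda>g x. P g x + P' g x) \<in> diff_ops U"
| comp: "P \<in> diff_ops U \<Longrightarrow> P' \<in> diff_ops U \<Longrightarrow> P \<circ> P' \<in> diff_ops U"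

section \<open>The twisted modules\<close>

text \<open>A section \<open>h f\<^sup>\<lambda>\<close> of \<open>\<O>\<^sub>X[1/f] f\<^sup>\<lambda>\<close> over an open set \<open>U\<close> is represented by the coefficient
  \<open>h\<close>, as a function on \<open>U - divisor d f\<close>. This loses nothing, since \<open>f\<^sup>\<lambda>\<close> is a free
  generator and the complement of the divisor is dense. Values of \<open>h\<close> elsewhere are
  irrelevant.

  \<open>acts_as d f lam U P Q\<close> says that \<open>P (h f\<^sup>\<lambda>) = (Q h) f\<^sup>\<lambda>\<close> for the action determined by the
  chain and product rules.\<close>

inductive acts_as ::
  "nat \<Rightarrow> (nat \<Rightarrow> complex ^ 'n \<Rightarrow> complex) \<Rightarrow> (nat \<Rightarrow> complex) \<Rightarrow> (complex ^ 'n) set \<Rightarrow>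
   'n operator \<Rightarrow> 'n operator \<Rightarrow> bool"
  for d :: nat and f :: "nat \<Rightarrow> complex ^ 'n \<Rightarrow> complex" and lam :: "nat \<Rightarrow> complex"
    and U :: "(complex ^ 'n) set" where
  mult: "mv_holomorphic_on a U \<Longrightarrow>
    acts_as d f lam U (\<lambda>g x. a x * g x) (\<lambda>h x. a x * h x)"
| deriv: "(\<And>i. mv_holomorphic_on (\<lambda>x. b x $ i) U) \<Longrightarrow>
    acts_as d f lam U (derivation b)
      (\<lambda>h x. derivation b h x + h x * (\<Sum>k=1..d. lam k * derivation b (f k) x / f k x))"
| add: "acts_as d f lam U P Q \<Longrightarrow> acts_as d f lam U P' Q' \<Longrightarrow>
    acts_as d f lam U (\<lambda>g x. P g x + P' g x) (\<lambda>h x. Q h x + Q' h x)"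
| comp: "acts_as d f lam U P Q \<Longrightarrow> acts_as d f lam U P' Q' \<Longrightarrow>
    acts_as d f lam U (P \<circ> P') (Q \<circ> Q')"

lemma diff_ops_iff_acts_as: "P \<in> diff_ops U \<longleftrightarrow> (\<exists>Q. acts_as d f lam U P Q)"
proof
  assume "P \<in> diff_ops U"
  then show "\<exists>Q. acts_as d f lam U P Q"
    by induction (blast intro: acts_as.intros)+
next
  assume "\<exists>Q. acts_as d f lam U P Q"
  then obtain Q where "acts_as d f lam U P Q" ..
  then show "P \<in> diff_ops U"
    by induction (blast intro: diff_ops.intros)+
qed

text \<open>The coefficient of \<open>f\<^bsup>\<lambda>-p\<^esup> = (\<Prod>\<^sub>k f\<^sub>k\<^bsup>-p\<^esup>) f\<^sup>\<lambda>\<close>, where the exponent of \<open>f\<^sub>k\<close> is \<open>-p k\<close>.\<close>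

definition shifted_power ::
  "nat \<Rightarrow> (nat \<Rightarrow> complex ^ 'n \<Rightarrow> complex) \<Rightarrow> (nat \<Rightarrow> int) \<Rightarrow> complex ^ 'n \<Rightarrow> complex" where
  "shifted_power d f p x = (\<Prod>k=1..d. f k x powi (- p k))"

text \<open>The sections over \<open>U\<close> of the sheaf \<open>\<D>\<^sub>X s f\<^sup>\<lambda>\<close>, the image of \<open>P \<mapsto> P (s f\<^sup>\<lambda>)\<close>: those that
  are locally of this form.\<close>

definition cyclic_module ::
  "nat \<Rightarrow> (nat \<Rightarrow> complex ^ 'n \<Rightarrow> complex) \<Rightarrow> (nat \<Rightarrow> complex) \<Rightarrow> (complex ^ 'n \<Rightarrow> complex) \<Rightarrow>
   (complex ^ 'n) set \<Rightarrow> (complex ^ 'n \<Rightarrow> complex) set" where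
  "cyclic_module d f lam s U =
     {h. \<forall>x\<in>U. \<exists>V. open V \<and> x \<in> V \<and> V \<subseteq> U \<and>
        (\<exists>P\<in>diff_ops V. \<exists>Q. acts_as d f lam V P Q \<and>
           (\<forall>y\<in>V - divisor d f. h y = Q s y))}"

text \<open>The union, as a sheaf, of the \<open>\<D>\<^sub>X f\<^sup>\<lambda>\<^sup>-\<^sup>p\<close> for \<open>p \<in> \<nat>\<^sup>d\<close>: the exponent may
  depend on the point.\<close>

definition star_module ::
  "nat \<Rightarrow> (nat \<Rightarrow> complex ^ 'n \<Rightarrow> complex) \<Rightarrow> (nat \<Rightarrow> complex) \<Rightarrow>
   (complex ^ 'n) set \<Rightarrow> (complex ^ 'n \<Rightarrow> complex) set" where
  "star_module d f lam U =
     {h. \<forall>x\<in>U. \<exists>V. open V \<and> x \<in> V \<and> V \<subseteq> U \<and>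
        (\<exists>p :: nat \<Rightarrow> nat. h \<in> cyclic_module d f lam (shifted_power d f (\<lambda>k. int (p k))) V)}"

end

theory Submission
  imports Defs "HOL-Library.Function_Algebras"
begin

text \<open>Partial fractions reduce the theorem to showing that \<open>\<Prod>\<^sub>i\<^sub>\<in>\<^sub>B f\<^sub>i\<^bsup>-p\<^sub>i\<^esup> f\<^sup>\<lambda>\<close> lies in the module generated by
  \<open>f\<^sup>-\<^sup>1 f\<^sup>\<lambda>\<close> whenever the forms indexed by \<open>B\<close> are independent and all \<open>p\<^sub>i \<ge> 1\<close>. This goes by induction
  on the excess \<open>e = \<Sum>\<^sub>i\<^sub>\<in>\<^sub>B (p\<^sub>i - 1)\<close>. For \<open>e = 0\<close> it is clear, and for \<open>e = 1\<close> differentiate once, which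
  needs only \<open>\<lambda>\<^sub>j \<noteq> 1\<close>. For \<open>e \<ge> 2\<close> let \<open>S\<close> index the multiple poles and \<open>I = B - S\<close> the simple
  ones. Applying the Euler field of \<open>S\<close> gives, modulo fractions of smaller excess, a homogeneous
  linear system relating the fractions with the same part over \<open>S\<close> and varying \<open>I\<close>. By induction on
  \<open>|I|\<close> it has only the zero solution, because \<open>\<lambda>\<^sub>E \<noteq> e\<close> for every edge \<open>E\<close> contained in all hyperplanes
  of \<open>S\<close>, where \<open>\<lambda>\<^sub>E\<close> is the sum of the weights of the hyperplanes through \<open>E\<close>.\<close>

section \<open>Functionals, holomorphy and locality\<close>

text \<open>Turns relations modulo a subspace of functions into equations between complex numbers. A
  basis of \<open>N\<close> is extended by \<open>u\<close>; \<open>L\<close> sends \<open>u\<close>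
  to 1 and the basis to 0.\<close>

lemma exists_annihilating_functional:
  fixes N :: "('a \<Rightarrow> complex) set"
  assumes add: "\<And>g h. g \<in> N \<Longrightarrow> h \<in> N \<Longrightarrow> (\<lambda>x. g x + h x) \<in> N"
    and scale: "\<And>c h. h \<in> N \<Longrightarrow> (\<lambda>x. c * h x) \<in> N"
    and zero: "(\<lambda>x. 0) \<in> N"
    and u: "u \<notin> N"
  obtains L :: "('a \<Rightarrow> complex) \<Rightarrow> complex"
  where "\<And>g h. L (\<lambda>x. g x + h x) = L g + L h" "\<And>c h. L (\<lambda>x. c * h x) = c * L h"
    "\<And>h. h \<in> N \<Longrightarrow> L h = 0" "L u \<noteq> 0"
proof -
  define sc :: "complex \<Rightarrow> ('a \<Rightarrow> complex) \<Rightarrow> 'a \<Rightarrow> complex" where "sc = (\<lambda>c h x. c * h x)"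
  interpret F: vector_space sc
    by unfold_locales (auto simp: sc_def fun_eq_iff algebra_simps)
  interpret C: vector_space "(*) :: complex \<Rightarrow> complex \<Rightarrow> complex"
    by unfold_locales (auto simp: algebra_simps)
  interpret P: vector_space_pair sc "(*) :: complex \<Rightarrow> complex \<Rightarrow> complex"
    by unfold_locales
  have sub: "F.subspace N"
    unfolding F.subspace_def
    using add scale zero by (auto simp: sc_def plus_fun_def zero_fun_def)
  obtain B where B: "B \<subseteq> N" "F.independent B" "N \<subseteq> F.span B"
    using F.maximal_independent_subset by blast
  have span: "F.span B = N"
    using B sub by (metis F.span_minimal subset_antisym)
  have ind: "F.independent (insert u B)"
    using B(2) u span by (simp add: F.independent_insertI)
  define g :: "('a \<Rightarrow> complex) \<Rightarrow> complex" where "g = (\<lambda>h. if h = u then 1 else 0)"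
  obtain L where L: "Vector_Spaces.linear sc (*) L" "\<forall>x\<in>insert u B. L x = g x"
    using P.linear_independent_extend[OF ind] by blast
  interpret L: Vector_Spaces.linear sc "(*)" L by fact
  have uB: "u \<notin> B" using u B(1) by blast
  show ?thesis
  proof
    show "L (\<lambda>x. g x + h x) = L g + L h" for g h
      using L.add[of g h] by (simp add: plus_fun_def)
    show "L (\<lambda>x. c * h x) = c * L h" for c h
      using L.scale[of c h] by (simp add: sc_def)
    show "L h = 0" if "h \<in> N" for h
    proof -
      have "h \<in> F.span B" using that span by simp
      then show ?thesis
      proof (induction rule: F.span_induct)
        case base
        show ?case using P.linear_subspace_kernel[OF L(1)] .
      next
        case (step h)
        then show ?case using L(2) uB by (auto simp: g_def)
      qed
    qed
    show "L u \<noteq> 0" using L(2) by (simp add: g_def)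
  qed
qed

section \<open>Holomorphy of linear forms and locality of operators\<close>

lemma mv_holomorphic_on_const: "mv_holomorphic_on (\<lambda>x. c) U"
  unfolding mv_holomorphic_on_def by (auto intro!: exI[of _ "\<lambda>_. 0"])

lemma mv_holomorphic_on_subset: "mv_holomorphic_on g U \<Longrightarrow> V \<subseteq> U \<Longrightarrow> mv_holomorphic_on g V"
  unfolding mv_holomorphic_on_def by blast

lemma complex_linear_eq_sum:
  fixes g :: "complex ^ 'n \<Rightarrow> complex"
  assumes "Vector_Spaces.linear (*s) (*) g"
  shows "g x = (\<Sum>i\<in>UNIV. x $ i * g (axis i 1))"
proof -
  interpret g: Vector_Spaces.linear "(*s)" "(*)" g by fact
  have "g x = g (\<Sum>i\<in>UNIV. x $ i *s axis i 1)"
    by (simp add: basis_expansion)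
  then show ?thesis by (simp add: g.sum g.scale)
qed

lemma complex_linear_bounded_linear:
  fixes g :: "complex ^ 'n \<Rightarrow> complex"
  assumes "Vector_Spaces.linear (*s) (*) g"
  shows "bounded_linear g"
proof -
  have "bounded_linear (\<lambda>x. \<Sum>i\<in>UNIV. x $ i * g (axis i 1))"
    by (intro bounded_linear_sum bounded_linear_mult_const bounded_linear_vec_nth)
  moreover have "g = (\<lambda>x. \<Sum>i\<in>UNIV. x $ i * g (axis i 1))"
    using complex_linear_eq_sum[OF assms] by (rule ext)
  ultimately show ?thesis by (rule ssubst[rotated])
qed

lemma complex_linear_mv_holomorphic:
  fixes g :: "complex ^ 'n \<Rightarrow> complex"
  assumes "Vector_Spaces.linear (*s) (*) g"
  shows "mv_holomorphic_on g U"
proof -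
  interpret g: Vector_Spaces.linear "(*s)" "(*)" g by fact
  show ?thesis
    unfolding mv_holomorphic_on_def
    using bounded_linear_imp_has_derivative[OF complex_linear_bounded_linear[OF assms]] g.scale
    by blast
qed

lemma acts_as_subset:
  assumes "acts_as d f lam U P Q" "V \<subseteq> U"
  shows "acts_as d f lam V P Q"
  using assms
proof induction
  case (mult a)
  then show ?case by (intro acts_as.mult mv_holomorphic_on_subset[of a U V])
next
  case (deriv b)
  show ?case
    by (rule acts_as.deriv) (rule mv_holomorphic_on_subset[OF deriv(1) deriv(2)])
qed (auto intro: acts_as.intros)

text \<open>For small parameters, the line through \<open>x\<close> in a coordinate direction stays
  in \<open>W\<close>, so the partial derivatives at \<open>x\<close> see only values on
  \<open>W\<close>.\<close>

lemma derivation_cong_open: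
  assumes W: "open W" "x \<in> W" and eq: "\<And>y. y \<in> W \<Longrightarrow> g y = h y"
  shows "derivation b g x = derivation b h x"
proof -
  have "partial i g x = partial i h x" for i
    unfolding partial_def
  proof (rule deriv_cong_ev)
    have "(\<lambda>t. x + t *s axis i (1::complex)) = (\<lambda>t. \<chi> k. x $ k + t * axis i 1 $ k)"
      by (simp add: fun_eq_iff vec_eq_iff)
    moreover have "continuous_on UNIV (\<lambda>t. \<chi> k. x $ k + t * axis i (1::complex) $ k)"
      by (intro continuous_on_vec_lambda continuous_on_add continuous_on_mult continuous_on_const
          continuous_on_id)
    ultimately have "isCont (\<lambda>t. x + t *s axis i (1::complex)) 0"
      by (simp add: continuous_on_eq_continuous_at)
    then have "((\<lambda>t. x + t *s axis i (1::complex)) \<longlongrightarrow> x + 0 *s axis i 1) (nhds 0)"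
      using tendsto_at_iff_tendsto_nhds[of "\<lambda>t. x + t *s axis i (1::complex)" 0]
      by (simp add: isCont_def)
    then have "\<forall>\<^sub>F t in nhds 0. x + t *s axis i (1::complex) \<in> W"
      by (rule topological_tendstoD) (use W in simp_all)
    then show "\<forall>\<^sub>F t in nhds 0. g (x + t *s axis i 1) = h (x + t *s axis i 1)"
      by (rule eventually_mono) (rule eq)
  qed simp
  then show ?thesis by (simp add: derivation_def)
qed

lemma acts_as_cong_open:
  assumes "acts_as d f lam U P Q" "open W" "\<And>y. y \<in> W \<Longrightarrow> g y = h y" "x \<in> W"
  shows "Q g x = Q h x"
  using assms
proof (induction arbitrary: g h x)
  case (deriv b)
  then show ?case using derivation_cong_open[of W x g h b] by simp
next
  case (comp P Q P' Q')
  \<comment> \<open>The results of the inner operator agree on all of \<open>W\<close>, not only at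
    \<open>x\<close>; the outer operator needs this.\<close>
  have "Q (Q' g) x = Q (Q' h) x"
    by (rule comp.IH(1)[OF \<open>open W\<close> _ \<open>x \<in> W\<close>])
      (rule comp.IH(2)[OF \<open>open W\<close> comp.prems(2)])
  then show ?case by simp
next
  case (add P Q P' Q')
  then show ?case by metis
qed auto

section \<open>Flats of linear forms and the residue system\<close>

locale linear_forms =
  fixes A :: "nat set" and f :: "nat \<Rightarrow> complex ^ 'n \<Rightarrow> complex"
  assumes finite_index: "finite A"
    and linear_form: "\<And>k. k \<in> A \<Longrightarrow> Vector_Spaces.linear (*s) (*) (f k)"
begin

lemma form_add: "k \<in> A \<Longrightarrow> f k (x + y) = f k x + f k y"
  and form_diff: "k \<in> A \<Longrightarrow> f k (x - y) = f k x - f k y"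
  and form_scale: "k \<in> A \<Longrightarrow> f k (c *s x) = c * f k x"
  and form_sum: "k \<in> A \<Longrightarrow> f k (\<Sum>i\<in>I. h i) = (\<Sum>i\<in>I. f k (h i))"
proof -
  assume "k \<in> A"
  then interpret f: Vector_Spaces.linear "(*s)" "(*)" "f k" by (rule linear_form)
  show "f k (x + y) = f k x + f k y" by (rule f.add)
  show "f k (x - y) = f k x - f k y" by (rule f.diff)
  show "f k (c *s x) = c * f k x" by (rule f.scale)
  show "f k (\<Sum>i\<in>I. h i) = (\<Sum>i\<in>I. f k (h i))" by (rule f.sum)
qed

definition dual :: "nat set \<Rightarrow> (nat \<Rightarrow> complex ^ 'n) \<Rightarrow> bool" where
  "dual B \<theta> \<longleftrightarrow> (\<forall>i\<in>B. \<forall>j\<in>B. f i (\<theta> j) = (if i = j then 1 else 0))"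

text \<open>For \<open>B \<subseteq> A\<close> this is linear independence of the indexed family.
  Dual vectors are the witnesses because the later computations differentiate along them.\<close>

definition indep :: "nat set \<Rightarrow> bool" where
  "indep B \<longleftrightarrow> (\<exists>\<theta>. dual B \<theta>)"

text \<open>The matroid closure: for \<open>B \<subseteq> A\<close>, it indexes the forms in the
  linear span of those of \<open>B\<close>.\<close>

definition flat :: "nat set \<Rightarrow> nat set" where
  "flat B = {k\<in>A. \<forall>x. (\<forall>i\<in>B. f i x = 0) \<longrightarrow> f k x = 0}"

lemma flat_eq_hyperplanes: "flat B = {k\<in>A. (\<Inter>k\<in>B. hyperplane f k) \<subseteq> hyperplane f k}"
  by (auto simp: flat_def hyperplane_def)

lemma flat_subset: "flat B \<subseteq> A"
  by (auto simp: flat_def)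

lemma finite_flat: "finite (flat B)"
  using finite_subset[OF flat_subset finite_index] .

lemma subset_flat: "B \<subseteq> A \<Longrightarrow> B \<subseteq> flat B"
  by (auto simp: flat_def)

lemma flat_subset_flat: "B \<subseteq> flat C \<Longrightarrow> flat B \<subseteq> flat C"
  by (fastforce simp: flat_def)

lemma flat_eval: "k \<in> flat B \<Longrightarrow> (\<And>i. i \<in> B \<Longrightarrow> f i x = 0) \<Longrightarrow> f k x = 0"
  by (auto simp: flat_def)

lemma dual_other: "dual B \<theta> \<Longrightarrow> i \<in> B \<Longrightarrow> j \<in> B \<Longrightarrow> i \<noteq> j \<Longrightarrow> f i (\<theta> j) = 0"
  by (auto simp: dual_def)

lemma dual_subset: "dual B \<theta> \<Longrightarrow> C \<subseteq> B \<Longrightarrow> dual C \<theta>"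
  unfolding dual_def by blast

text \<open>Subtracting \<open>\<Sum>i\<in>B. f i x *s \<theta> i\<close> from \<open>x\<close>
  leaves a vector killed by all forms of \<open>B\<close>, hence by \<open>f k\<close>.\<close>

lemma flat_expand:
  assumes B: "B \<subseteq> A" "dual B \<theta>" and k: "k \<in> flat B"
  shows "f k x = (\<Sum>i\<in>B. f k (\<theta> i) * f i x)"
proof -
  have fin: "finite B" using B(1) finite_index by (rule finite_subset)
  have kA: "k \<in> A" using k flat_subset by blast
  define y where "y = x - (\<Sum>i\<in>B. f i x *s \<theta> i)"
  have y: "f j y = f j x - (\<Sum>i\<in>B. f i x * f j (\<theta> i))" if "j \<in> A" for j
    using that by (simp add: y_def form_diff form_sum form_scale)
  have "f j y = 0" if j: "j \<in> B" for j
  proof -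
    have "(\<Sum>i\<in>B. f i x * f j (\<theta> i)) = (\<Sum>i\<in>B. if i = j then f j x else 0)"
      using B(2) j by (intro sum.cong) (auto simp: dual_def)
    then show ?thesis using y[of j] B(1) j fin by auto
  qed
  then have "f k y = 0" by (rule flat_eval[OF k])
  then show ?thesis using y[OF kA] by (simp add: mult.commute)
qed

text \<open>The vector \<open>v\<close> is rescaled to pair to 1 with \<open>f k\<close>. Each old
  vector is corrected by a multiple of \<open>v\<close>, which makes \<open>f k\<close> vanish on it
  and affects no form of \<open>B\<close>.\<close>

lemma dual_insert:
  assumes B: "B \<subseteq> A" "dual B \<theta>" and v: "\<And>i. i \<in> B \<Longrightarrow> f i v = 0" and k: "k \<in> A" "f k v \<noteq> 0"
  shows "dual (insert k B)
    (\<lambda>i. if i = k then (1 / f k v) *s v else \<theta> i - (f k (\<theta> i) / f k v) *s v)"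
  using assms by (auto simp: dual_def form_diff form_scale subset_iff)

lemma indep_insert:
  assumes "B \<subseteq> A" "indep B" "k \<in> A" "k \<notin> flat B"
  shows "indep (insert k B)"
proof -
  obtain v where "\<forall>i\<in>B. f i v = 0" "f k v \<noteq> 0"
    using assms(3,4) by (auto simp: flat_def)
  then show ?thesis
    using assms dual_insert unfolding indep_def by meson
qed

text \<open>With the indices added in increasing order, \<open>l\<close> is the first at which
  independence fails. The order matters for the termination of the partial fraction
  expansion.\<close>

lemma indep_or_dependent_on_smaller:
  assumes "B \<subseteq> A"
  shows "indep B \<or> (\<exists>l\<in>B. indep (B \<inter> {..<l}) \<and> l \<in> flat (B \<inter> {..<l}))"
proof -
  have "finite B" using assms finite_index by (rule finite_subset)
  then show ?thesis using assms
  proof (induction rule: finite_linorder_max_induct)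
    case empty
    then show ?case by (simp add: indep_def dual_def)
  next
    case (insert b B)
    have eq: "insert b B \<inter> {..<b} = B" using insert(2) by auto
    have eq': "insert b B \<inter> {..<l} = B \<inter> {..<l}" if "l \<in> B" for l
      using insert(2) that by force
    show ?case
    proof (cases "indep B")
      case True
      show ?thesis
      proof (cases "b \<in> flat B")
        case True
        with \<open>indep B\<close> show ?thesis using eq by auto
      next
        case False
        with \<open>indep B\<close> show ?thesis using indep_insert insert.prems by auto
      qed
    next
      case False
      then show ?thesis using insert.IH insert.prems eq' by auto
    qed
  qed
qed

text \<open>Here \<open>\<phi> I\<close> stands for \<open>w \<Prod>\<^sub>i\<^sub>\<in>\<^sub>I f\<^sub>i\<^sup>-\<^sup>1\<close> with a fixed factor \<open>w\<close>. In terms of the forms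
  \<open>w \<And>\<^sub>i\<^sub>\<in>\<^sub>I df\<^sub>i / f\<^sub>i\<close>, the passage from \<open>\<phi>\<close> to \<open>\<psi>\<close> in the proof is multiplication
  by \<open>\<Sum>\<^sub>k \<lambda>\<^sub>k df\<^sub>k / f\<^sub>k\<close>. Its square is zero, whence \<open>\<psi>\<close> satisfies the same system on a flat of smaller rank.\<close>

lemma residue_system_trivial:
  fixes lam :: "nat \<Rightarrow> complex" and \<phi> :: "nat set \<Rightarrow> complex"
  assumes S: "S \<subseteq> A"
    and c: "\<And>C. S \<subseteq> C \<Longrightarrow> C \<subseteq> A \<Longrightarrow> (\<Sum>k\<in>flat C. lam k) \<noteq> c"
    and J: "J \<subseteq> A" "J \<inter> S = {}" "indep (S \<union> J)"
    and system: "\<And>I \<theta>. I \<subseteq> A \<Longrightarrow> I \<inter> S = {} \<Longrightarrow> flat (S \<union> I) = flat (S \<union> J) \<Longrightarrow> dual (S \<union> I) \<theta> \<Longrightarrow>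
      ((\<Sum>k\<in>flat (S \<union> J). lam k) - c) * \<phi> I =
      (\<Sum>i\<in>I. \<Sum>k\<in>flat (S \<union> J). lam k * f k (\<theta> i) * \<phi> (insert k (I - {i})))"
  shows "\<phi> J = 0"
  using J system
proof (induction "card J" arbitrary: J \<phi> rule: less_induct)
  case less
  note J = less.prems(1-3)
  define E where "E = flat (S \<union> J)"
  note system = less.prems(4)[folded E_def]
  have finJ: "finite J" using J(1) finite_index by (rule finite_subset)
  have SJ: "S \<union> J \<subseteq> A" using S J(1) by blast
  have EA: "E \<subseteq> A" unfolding E_def by (rule flat_subset)
  have finE: "finite E" unfolding E_def by (rule finite_flat)
  obtain \<theta> where \<theta>: "dual (S \<union> J) \<theta>" using J(3) unfolding indep_def by blast
  define \<psi> where "\<psi> = (\<lambda>I v. \<Sum>k\<in>E. lam k * f k v * \<phi> (insert k I))"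
  \<comment> \<open>By \<open>system\<close> at \<open>J\<close>, the number
    \<open>((\<Sum>k\<in>E. lam k) - c) * \<phi> J\<close> is the sum of these values over
    \<open>i \<in> J\<close>. Each vanishes by the induction hypothesis for \<open>J - {i}\<close>,
    applied to \<open>\<psi>\<close> with its second argument fixed.\<close>
  have "\<psi> (J - {i}) (\<theta> i) = 0" if i: "i \<in> J" for i
  proof -
    define K v F where "K = J - {i}" and "v = \<theta> i" and "F = flat (S \<union> K)"
    have SK: "S \<union> K \<subseteq> A" using SJ by (auto simp: K_def)
    have iSK: "i \<notin> S \<union> K" and SJi: "S \<union> J = insert i (S \<union> K)"
      using i J(2) by (auto simp: K_def)
    have kill: "f l v = 0" if "l \<in> S \<union> K" for l
      using \<theta> that i iSK unfolding v_def SJi by (intro dual_other[OF \<theta>[unfolded SJi]]) auto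
    have vF: "f k v = 0" if "k \<in> F" for k
      using that[unfolded F_def] kill by (rule flat_eval)
    \<comment> \<open>On the common zeros of the forms of \<open>S \<union> K\<close>, every form of
      \<open>E\<close> is a multiple of \<open>f i\<close>. Hence \<open>F\<close> consists of the
      \<open>k \<in> E\<close> with \<open>f k v = 0\<close>.\<close>
    have expand: "f k x = f k v * f i x"
      if k: "k \<in> E" and x: "\<And>l. l \<in> S \<union> K \<Longrightarrow> f l x = 0" for k x
    proof -
      have "f k x = (\<Sum>l\<in>S \<union> J. f k (\<theta> l) * f l x)"
        using flat_expand[OF SJ \<theta>] k unfolding E_def by blast
      also have "\<dots> = f k v * f i x"
        unfolding SJi using finite_subset[OF SK finite_index] iSK x
        by (simp add: v_def)
      finally show ?thesis .
    qed
    have EF: "k \<in> F" if "k \<in> E" "f k v = 0" for k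
      using expand[OF that(1)] that EA unfolding F_def flat_def by auto
    have FE: "F \<subseteq> E"
      unfolding F_def E_def using subset_flat[OF SJ] SJi by (intro flat_subset_flat) auto
    have "\<psi> K v = 0"
    proof (rule less.hyps[of K "\<lambda>I. \<psi> I v"])
      show "card K < card J" unfolding K_def using i finJ by (rule card_Diff1_less[rotated])
      show "K \<subseteq> A" "K \<inter> S = {}" using SK J(2) by (auto simp: K_def)
      show "indep (S \<union> K)"
        unfolding indep_def using dual_subset[OF \<theta>] SJi by blast
    next
      fix J' \<eta>
      assume J': "J' \<subseteq> A" "J' \<inter> S = {}" "flat (S \<union> J') = flat (S \<union> K)" "dual (S \<union> J') \<eta>"
      have SJ': "S \<union> J' \<subseteq> A" using S J' by blast
      have finJ': "finite J'" using J'(1) finite_index by (rule finite_subset)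
      have J'F: "S \<union> J' \<subseteq> F" using subset_flat[OF SJ'] J'(3) unfolding F_def by simp
      \<comment> \<open>A 2 by 2 determinant times a factor symmetric in \<open>k\<close> and
        \<open>l\<close>, hence antisymmetric in them.\<close>
      define D where "D = (\<lambda>j k l. (f k v * f l (\<eta> j) - f k (\<eta> j) * f l v) *
        \<phi> (insert l (insert k (J' - {j}))))"
      have D_swap: "D j l k = - D j k l" for j k l
        unfolding D_def by (simp add: insert_commute algebra_simps)
      \<comment> \<open>For \<open>k\<close> outside \<open>F\<close>, the set
        \<open>S \<union> insert k J'\<close> has flat \<open>E\<close> again, so the system for
        \<open>\<phi>\<close> applies to it. The factor \<open>f k v\<close> clears the denominators
        of the dual vectors \<open>\<zeta>\<close>.\<close>
      have key: "f k v * (((\<Sum>k\<in>E. lam k) - c) * \<phi> (insert k J')) =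
          \<psi> J' v + (\<Sum>j\<in>J'. \<Sum>l\<in>E. lam l * D j k l)" if k: "k \<in> E - F" for k
      proof -
        have fkv: "f k v \<noteq> 0" using k EF by blast
        have kA: "k \<in> A" using k EA by blast
        have kJ': "k \<notin> S \<union> J'" using k J'F by blast
        define \<zeta> where "\<zeta> = (\<lambda>i. if i = k then (1 / f k v) *s v else \<eta> i - (f k (\<eta> i) / f k v) *s v)"
        have dual: "dual (S \<union> insert k J') \<zeta>"
          unfolding \<zeta>_def using dual_insert[OF SJ' J'(4) _ kA fkv] J'F vF by auto
        have sub: "S \<union> insert k J' \<subseteq> A" using SJ' kA by blast
        have "flat (S \<union> insert k J') \<subseteq> E"
          unfolding E_def by (intro flat_subset_flat) (use k J'F FE in \<open>auto simp: E_def\<close>)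
        moreover have "E \<subseteq> flat (S \<union> insert k J')"
          unfolding E_def
        proof (rule flat_subset_flat, rule subsetI)
          fix l assume l: "l \<in> S \<union> J"
          have "f l x = 0" if x: "\<And>m. m \<in> S \<union> insert k J' \<Longrightarrow> f m x = 0" for x
          proof -
            have xF: "f m x = 0" if "m \<in> F" for m
              using that[unfolded F_def J'(3)[symmetric]] x by (rule flat_eval) auto
            then have xK: "f m x = 0" if "m \<in> S \<union> K" for m
              using subset_flat[OF SK] that unfolding F_def by blast
            have "f k v * f i x = 0" using expand[of k x] xK x[of k] k by simp
            then show ?thesis using fkv l xK unfolding SJi by auto
          qed
          then show "l \<in> flat (S \<union> insert k J')" using l SJ by (auto simp: flat_def)
        qed
        ultimately have flat: "flat (S \<union> insert k J') = E" by blast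
        have "((\<Sum>k\<in>E. lam k) - c) * \<phi> (insert k J') =
          (\<Sum>j\<in>insert k J'. \<Sum>l\<in>E. lam l * f l (\<zeta> j) * \<phi> (insert l (insert k J' - {j})))"
          using sub J'(2) kJ' flat dual by (intro system) auto
        also have "\<dots> = (\<Sum>l\<in>E. lam l * f l (\<zeta> k) * \<phi> (insert l J')) +
            (\<Sum>j\<in>J'. \<Sum>l\<in>E. lam l * f l (\<zeta> j) * \<phi> (insert l (insert k (J' - {j}))))"
        proof -
          have "insert k J' - {k} = J'" using kJ' by blast
          moreover have "insert k J' - {j} = insert k (J' - {j})" if "j \<in> J'" for j
            using kJ' that by blast
          ultimately show ?thesis using finJ' kJ' by simp
        qed
        finally have "f k v * (((\<Sum>k\<in>E. lam k) - c) * \<phi> (insert k J')) =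
            (\<Sum>l\<in>E. lam l * (f k v * f l (\<zeta> k)) * \<phi> (insert l J')) +
            (\<Sum>j\<in>J'. \<Sum>l\<in>E. lam l * (f k v * f l (\<zeta> j)) * \<phi> (insert l (insert k (J' - {j}))))"
          by (simp add: sum_distrib_left distrib_left mult_ac)
        also have "(\<Sum>l\<in>E. lam l * (f k v * f l (\<zeta> k)) * \<phi> (insert l J')) = \<psi> J' v"
          unfolding \<psi>_def using EA fkv by (intro sum.cong) (auto simp: \<zeta>_def form_scale subset_iff)
        also have "(\<Sum>j\<in>J'. \<Sum>l\<in>E. lam l * (f k v * f l (\<zeta> j)) * \<phi> (insert l (insert k (J' - {j})))) =
            (\<Sum>j\<in>J'. \<Sum>l\<in>E. lam l * D j k l)"
        proof (intro sum.cong refl)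
          fix j l assume "j \<in> J'" "l \<in> E"
          then have "f k v * f l (\<zeta> j) = f k v * f l (\<eta> j) - f k (\<eta> j) * f l v"
            using kJ' EA fkv by (auto simp: \<zeta>_def form_diff form_scale subset_iff field_simps)
          then show "lam l * (f k v * f l (\<zeta> j)) * \<phi> (insert l (insert k (J' - {j}))) = lam l * D j k l"
            by (simp add: D_def)
        qed
        finally show ?thesis .
      qed
      \<comment> \<open>Exchanging \<open>k\<close> and \<open>l\<close> negates the sum: this is
        the vanishing of the square of a 1-form.\<close>
      have anti: "(\<Sum>k\<in>E. lam k * (\<Sum>j\<in>J'. \<Sum>l\<in>E. lam l * D j k l)) = 0"
      proof -
        define T where "T = (\<lambda>j. \<Sum>k\<in>E. \<Sum>l\<in>E. lam k * (lam l * D j k l))"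
        have "T j = 0" for j
        proof -
          have "T j = (\<Sum>l\<in>E. \<Sum>k\<in>E. lam k * (lam l * D j k l))"
            unfolding T_def by (rule sum.swap)
          also have "\<dots> = (\<Sum>l\<in>E. \<Sum>k\<in>E. - (lam l * (lam k * D j l k)))"
            by (intro sum.cong refl) (subst D_swap, simp add: mult.left_commute)
          also have "\<dots> = - T j" unfolding T_def by (simp add: sum_negf)
          finally have "T j + T j = 0" by (rule eq_neg_iff_add_eq_0[THEN iffD1])
          then show ?thesis by (simp flip: mult_2)
        qed
        moreover have "(\<Sum>k\<in>E. lam k * (\<Sum>j\<in>J'. \<Sum>l\<in>E. lam l * D j k l)) = (\<Sum>j\<in>J'. T j)"
          unfolding T_def by (subst sum.swap) (simp only: sum_distrib_left)
        ultimately show ?thesis by simp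
      qed
      have split: "sum g E = sum g (E - F) + sum g F" for g :: "nat \<Rightarrow> complex"
        using sum.subset_diff[OF FE finE] .
      \<comment> \<open>The terms with \<open>k \<in> F\<close> vanish and \<open>key\<close>
        rewrites the others. Then \<open>anti\<close> replaces the sum of determinants over
        \<open>E - F\<close> by minus the one over \<open>F\<close>.\<close>
      have "((\<Sum>k\<in>E. lam k) - c) * \<psi> J' v =
          (\<Sum>k\<in>E. lam k * (f k v * (((\<Sum>k\<in>E. lam k) - c) * \<phi> (insert k J'))))"
        unfolding \<psi>_def by (simp add: sum_distrib_left mult_ac)
      also have "\<dots> = (\<Sum>k\<in>E - F. lam k * (f k v * (((\<Sum>k\<in>E. lam k) - c) * \<phi> (insert k J'))))"
        by (subst split) (simp add: vF)
      also have "\<dots> = (\<Sum>k\<in>E - F. lam k * (\<psi> J' v + (\<Sum>j\<in>J'. \<Sum>l\<in>E. lam l * D j k l)))"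
        by (intro sum.cong refl) (simp only: key)
      also have "\<dots> = (\<Sum>k\<in>E - F. lam k) * \<psi> J' v -
          (\<Sum>k\<in>F. lam k * (\<Sum>j\<in>J'. \<Sum>l\<in>E. lam l * D j k l))"
        using anti unfolding split[of "\<lambda>k. lam k * (\<Sum>j\<in>J'. \<Sum>l\<in>E. lam l * D j k l)"]
        by (simp add: distrib_left sum.distrib sum_distrib_right add_eq_0_iff)
      \<comment> \<open>For \<open>k \<in> F\<close> only the second product of the determinant
        survives, and its sum over \<open>l\<close> is a value of \<open>\<psi>\<close>.\<close>
      also have "(\<Sum>k\<in>F. lam k * (\<Sum>j\<in>J'. \<Sum>l\<in>E. lam l * D j k l)) =
          - (\<Sum>j\<in>J'. \<Sum>k\<in>F. lam k * f k (\<eta> j) * \<psi> (insert k (J' - {j})) v)"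
        unfolding sum_distrib_left[of "lam _" _ J'] \<psi>_def D_def sum_negf[symmetric]
        by (subst sum.swap, intro sum.cong refl)
          (simp add: vF sum_distrib_left sum_negf[symmetric] mult_ac)
      finally have "((\<Sum>k\<in>E. lam k) - c) * \<psi> J' v = (\<Sum>k\<in>E - F. lam k) * \<psi> J' v +
          (\<Sum>j\<in>J'. \<Sum>k\<in>F. lam k * f k (\<eta> j) * \<psi> (insert k (J' - {j})) v)"
        by simp
      \<comment> \<open>The weights of \<open>E - F\<close> cancel, leaving the system for the
        smaller flat \<open>F\<close> with the same constant \<open>c\<close>.\<close>
      then show "((\<Sum>k\<in>flat (S \<union> K). lam k) - c) * \<psi> J' v = (\<Sum>j\<in>J'. \<Sum>k\<in>flat (S \<union> K).
          lam k * f k (\<eta> j) * \<psi> (insert k (J' - {j})) v)"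
        unfolding F_def[symmetric] split[of lam] by (simp add: algebra_simps)
    qed
    then show ?thesis by (simp add: K_def v_def)
  qed
  then have "((\<Sum>k\<in>E. lam k) - c) * \<phi> J = 0"
    using system[OF J(1,2) _ \<theta>] by (simp add: \<psi>_def E_def)
  moreover have "(\<Sum>k\<in>E. lam k) \<noteq> c" unfolding E_def using SJ by (intro c) auto
  ultimately show ?case by simp
qed

end

section \<open>The module generated by \<open>f\<^sup>-\<^sup>1 f\<^sup>\<lambda>\<close>\<close>

locale twisted_arrangement = linear_forms "{1..d}" f
  for d :: nat and f :: "nat \<Rightarrow> complex ^ 'n \<Rightarrow> complex" +
  fixes lam :: "nat \<Rightarrow> complex"
begin

lemma not_in_divisor: "x \<notin> divisor d f \<longleftrightarrow> (\<forall>k\<in>{1..d}. f k x \<noteq> 0)"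
  by (auto simp: divisor_def)

lemma nonzero_off_divisor: "x \<notin> divisor d f \<Longrightarrow> k \<in> {1..d} \<Longrightarrow> f k x \<noteq> 0"
  by (simp add: not_in_divisor)

lemma open_Compl_divisor: "open (- divisor d f)"
proof -
  have "continuous_on UNIV (f k)" if "k \<in> {1..d}" for k
    using complex_linear_bounded_linear[OF linear_form[OF that]]
    by (rule linear_continuous_on)
  then have "continuous_on UNIV (\<lambda>x. \<Prod>k=1..d. f k x)"
    by (intro continuous_on_prod)
  then show ?thesis
    unfolding divisor_def open_closed[symmetric] closed_def[symmetric]
    by (intro closed_Collect_eq continuous_on_const)
qed

text \<open>Global operators are enough: the proof uses only constants, linear forms and constant
  vector fields, and restriction to open sets gives the local statement.\<close>

definition generated :: "(complex ^ 'n \<Rightarrow> complex) set" where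
  "generated = {h. \<exists>P Q. acts_as d f lam UNIV P Q \<and>
     (\<forall>y. y \<notin> divisor d f \<longrightarrow> h y = Q (shifted_power d f (\<lambda>k. 1)) y)}"

lemma generated_cong:
  "h \<in> generated \<Longrightarrow> (\<And>y. y \<notin> divisor d f \<Longrightarrow> h y = h' y) \<Longrightarrow> h' \<in> generated"
  unfolding generated_def by (auto 4 4)

lemma generated_mult:
  assumes "mv_holomorphic_on a UNIV" "h \<in> generated"
  shows "(\<lambda>x. a x * h x) \<in> generated"
proof -
  obtain P Q where PQ: "acts_as d f lam UNIV P Q"
      "\<forall>y. y \<notin> divisor d f \<longrightarrow> h y = Q (shifted_power d f (\<lambda>k. 1)) y"
    using assms(2) unfolding generated_def by blast
  show ?thesis
    unfolding generated_def mem_Collect_eq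
    by (intro exI conjI, rule acts_as.comp[OF acts_as.mult[OF assms(1)] PQ(1)])
      (use PQ(2) in simp)
qed

lemma generated_scale: "h \<in> generated \<Longrightarrow> (\<lambda>x. c * h x) \<in> generated"
  using generated_mult[OF mv_holomorphic_on_const] .

lemma generated_add:
  assumes "g \<in> generated" "h \<in> generated"
  shows "(\<lambda>x. g x + h x) \<in> generated"
proof -
  obtain P Q where PQ: "acts_as d f lam UNIV P Q"
      "\<forall>y. y \<notin> divisor d f \<longrightarrow> g y = Q (shifted_power d f (\<lambda>k. 1)) y"
    using assms(1) unfolding generated_def by blast
  obtain P' Q' where PQ': "acts_as d f lam UNIV P' Q'"
      "\<forall>y. y \<notin> divisor d f \<longrightarrow> h y = Q' (shifted_power d f (\<lambda>k. 1)) y"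
    using assms(2) unfolding generated_def by blast
  show ?thesis
    unfolding generated_def mem_Collect_eq
    by (intro exI conjI, rule acts_as.add[OF PQ(1) PQ'(1)]) (use PQ(2) PQ'(2) in simp)
qed

lemma generated_one: "shifted_power d f (\<lambda>k. 1) \<in> generated"
  unfolding generated_def mem_Collect_eq
  by (intro exI conjI, rule acts_as.mult[OF mv_holomorphic_on_const[of 1]]) simp

lemma generated_zero: "(\<lambda>x. 0) \<in> generated"
  using generated_scale[OF generated_one, of 0] by simp

lemma generated_diff: "g \<in> generated \<Longrightarrow> h \<in> generated \<Longrightarrow> (\<lambda>x. g x - h x) \<in> generated"
  using generated_add[OF _ generated_scale[of h "-1"], of g] by simp

lemma generated_sum:
  "(\<And>i. i \<in> I \<Longrightarrow> h i \<in> generated) \<Longrightarrow> (\<lambda>x. \<Sum>i\<in>I. h i x) \<in> generated"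
proof (induction I rule: infinite_finite_induct)
  case (insert i I)
  then show ?case using generated_add[of "h i" "\<lambda>x. \<Sum>i\<in>I. h i x"] by simp
qed (simp_all add: generated_zero)

lemma form_line: "k \<in> {1..d} \<Longrightarrow> f k (x + t *s v) = f k x + t * f k v"
  by (simp add: form_add form_scale)

lemma derivation_form:
  assumes k: "k \<in> {1..d}"
  shows "derivation (\<lambda>_. \<theta>) (f k) x = f k \<theta>"
proof -
  have "partial i (f k) x = f k (axis i 1)" for i
    unfolding partial_def form_line[OF k]
    by (rule DERIV_imp_deriv) (auto intro!: derivative_eq_intros)
  then show ?thesis
    using complex_linear_eq_sum[OF linear_form[OF k], of \<theta>] by (simp add: derivation_def)
qed

lemma generated_derivation:
  assumes "h \<in> generated"
  shows "(\<lambda>x. derivation (\<lambda>_. \<theta>) h x + h x * (\<Sum>k=1..d. lam k * f k \<theta> / f k x)) \<in> generated"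
proof -
  obtain P Q where PQ: "acts_as d f lam UNIV P Q"
      "\<forall>y. y \<notin> divisor d f \<longrightarrow> h y = Q (shifted_power d f (\<lambda>k. 1)) y"
    using assms unfolding generated_def by blast
  have act: "acts_as d f lam UNIV (derivation (\<lambda>_. \<theta>)) (\<lambda>h x. derivation (\<lambda>_. \<theta>) h x +
      h x * (\<Sum>k=1..d. lam k * derivation (\<lambda>_. \<theta>) (f k) x / f k x))"
    by (rule acts_as.deriv) (rule mv_holomorphic_on_const)
  have eq: "derivation (\<lambda>_. \<theta>) h y = derivation (\<lambda>_. \<theta>) (Q (shifted_power d f (\<lambda>k. 1))) y"
    if "y \<notin> divisor d f" for y
    using open_Compl_divisor by (rule derivation_cong_open) (use that PQ(2) in auto)
  show ?thesis
    unfolding generated_def mem_Collect_eq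
    by (intro exI conjI, rule acts_as.comp[OF act PQ(1)])
      (use PQ(2) eq in \<open>simp add: derivation_form\<close>)
qed

section \<open>Monomials in the inverse forms and their derivatives\<close>

definition monomial :: "nat set \<Rightarrow> (nat \<Rightarrow> nat) \<Rightarrow> complex ^ 'n \<Rightarrow> complex" where
  "monomial B p x = (\<Prod>k\<in>B. inverse (f k x) ^ p k)"

lemma monomial_cong: "(\<And>k. k \<in> B \<Longrightarrow> p k = q k) \<Longrightarrow> monomial B p = monomial B q"
  by (simp add: monomial_def fun_eq_iff)

lemma monomial_insert:
  "finite B \<Longrightarrow> k \<notin> B \<Longrightarrow> monomial (insert k B) p x = inverse (f k x) ^ p k * monomial B p x"
  by (simp add: monomial_def)

lemma monomial_remove:
  "finite B \<Longrightarrow> k \<in> B \<Longrightarrow> monomial B p x = inverse (f k x) ^ p k * monomial (B - {k}) p x"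
  by (simp add: monomial_def prod.remove)

lemma monomial_lower:
  assumes "finite B" "j \<in> B" "p j \<ge> 1" "f j x \<noteq> 0"
  shows "monomial B (p(j := p j - 1)) x = f j x * monomial B p x"
proof -
  have "monomial (B - {j}) (p(j := p j - 1)) = monomial (B - {j}) p"
    by (rule monomial_cong) auto
  moreover obtain m where "p j = Suc m" using assms(3) by (cases "p j") auto
  ultimately show ?thesis
    using assms by (simp add: monomial_remove[of B j])
qed

text \<open>The derivative along a line in direction \<open>v\<close> is found by induction on
  \<open>B\<close> and applied to the coordinate directions; linearity of the forms reassembles
  \<open>\<theta>\<close>.\<close>

lemma derivation_monomial:
  assumes B: "B \<subseteq> {1..d}" and x: "x \<notin> divisor d f"
  shows "derivation (\<lambda>_. \<theta>) (monomial B p) x =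
    - (\<Sum>k\<in>B. of_nat (p k) * f k \<theta> / f k x) * monomial B p x"
proof -
  have fin: "finite B" using B finite_subset by blast
  have nz: "f k x \<noteq> 0" if "k \<in> B" for k using B that nonzero_off_divisor[OF x] by blast
  have deriv: "((\<lambda>t. monomial B p (x + t *s v)) has_field_derivative
      - (\<Sum>k\<in>B. of_nat (p k) * f k v / f k x) * monomial B p x) (at 0)" for v
    using fin B nz
  proof (induction B rule: finite_induct)
    case empty
    then show ?case by (simp add: monomial_def)
  next
    case (insert k B)
    have k: "k \<in> {1..d}" "f k x \<noteq> 0" using insert.prems by auto
    have "((\<lambda>t. inverse (f k (x + t *s v)) ^ p k) has_field_derivative
        - (of_nat (p k) * f k v / f k x) * inverse (f k x) ^ p k) (at 0)"
    proof -
      have "((\<lambda>t. inverse (f k (x + t *s v))) has_field_derivative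
          - (f k v / (f k x * f k x))) (at 0)"
        unfolding form_line[OF k(1)] using k(2)
        by (auto intro!: derivative_eq_intros simp: field_simps)
      from DERIV_power[OF this, of "p k"] show ?thesis
        using k(2) by (cases "p k") (auto simp: field_simps)
    qed
    from DERIV_mult[OF this insert.IH] show ?case
      using insert by (simp add: monomial_insert algebra_simps)
  qed
  have "partial i (monomial B p) x =
      - (\<Sum>k\<in>B. of_nat (p k) * f k (axis i 1) / f k x) * monomial B p x" for i
    unfolding partial_def by (rule DERIV_imp_deriv[OF deriv])
  then have "derivation (\<lambda>_. \<theta>) (monomial B p) x =
      - (\<Sum>i\<in>UNIV. \<Sum>k\<in>B. \<theta> $ i * (of_nat (p k) * f k (axis i 1) / f k x)) * monomial B p x"
    by (simp add: derivation_def sum_distrib_left sum_distrib_right sum_negf mult_ac)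
  also have "(\<Sum>i\<in>UNIV. \<Sum>k\<in>B. \<theta> $ i * (of_nat (p k) * f k (axis i 1) / f k x)) =
      (\<Sum>k\<in>B. of_nat (p k) * (\<Sum>i\<in>UNIV. \<theta> $ i * f k (axis i 1)) / f k x)"
    by (subst sum.swap) (simp add: sum_distrib_left sum_divide_distrib mult_ac)
  also have "\<dots> = (\<Sum>k\<in>B. of_nat (p k) * f k \<theta> / f k x)"
    using B complex_linear_eq_sum[OF linear_form, of _ \<theta>] by (intro sum.cong) auto
  finally show ?thesis .
qed

lemma generated_derivation_monomial:
  assumes B: "B \<subseteq> {1..d}" and "monomial B p \<in> generated"
  shows "(\<lambda>x. ((\<Sum>k=1..d. lam k * f k \<theta> / f k x) - (\<Sum>k\<in>B. of_nat (p k) * f k \<theta> / f k x)) *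
    monomial B p x) \<in> generated"
  by (rule generated_cong[OF generated_derivation[OF assms(2), of \<theta>]])
    (simp add: derivation_monomial[OF B] algebra_simps)

text \<open>Multiplying the generator by the forms outside \<open>B\<close>, one at a time, cancels
  their poles.\<close>

lemma generated_reduced_monomial:
  assumes "B \<subseteq> {1..d}"
  shows "monomial B (\<lambda>_. 1) \<in> generated"
proof -
  have "monomial ({1..d} - D) (\<lambda>_. 1) \<in> generated" if "finite D" "D \<subseteq> {1..d}" for D
    using that
  proof (induction D rule: finite_induct)
    case empty
    show ?case
      by (rule generated_cong[OF generated_one])
        (simp add: shifted_power_def monomial_def power_int_minus)
  next
    case (insert k D)
    then have k: "k \<in> {1..d} - D" by blast
    have "(\<lambda>x. f k x * monomial ({1..d} - D) (\<lambda>_. 1) x) \<in> generated"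
      using insert k
      by (intro generated_mult complex_linear_mv_holomorphic linear_form) auto
    then show ?case
    proof (rule generated_cong)
      fix x assume "x \<notin> divisor d f"
      then have "f k x \<noteq> 0" using k nonzero_off_divisor by blast
      moreover have "{1..d} - insert k D = {1..d} - D - {k}" by blast
      ultimately show
        "f k x * monomial ({1..d} - D) (\<lambda>_. 1) x = monomial ({1..d} - insert k D) (\<lambda>_. 1) x"
        using monomial_remove[OF _ k, of "\<lambda>_. 1" x] by simp
    qed
  qed
  moreover have "{1..d} - ({1..d} - B) = B" using assms by blast
  ultimately show ?thesis by (metis Diff_subset finite_Diff finite_atLeastAtMost)
qed

subsection \<open>Reduction of pole order\<close>

text \<open>Differentiate the fraction with all exponents 1 along \<open>\<theta> j\<close>. The
  other forms of \<open>B\<close> drop out, forms outside \<open>B\<close> contribute fractions with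
  simple poles, and \<open>f j\<close> contributes the target with coefficient
  \<open>lam j - 1\<close>. The residue system is avoided here because weights of edges of higher
  rank may equal 1.\<close>

lemma generated_excess_one:
  assumes B: "B \<subseteq> {1..d}" "indep B" and j: "j \<in> B" "p j = 2"
    and p: "\<And>k. k \<in> B \<Longrightarrow> k \<noteq> j \<Longrightarrow> p k = 1" and lam: "lam j \<noteq> 1"
  shows "monomial B p \<in> generated"
proof -
  obtain \<theta> where \<theta>: "dual B \<theta>" using B(2) unfolding indep_def by blast
  have fin: "finite B" using B(1) finite_subset by blast
  define g where "g = (\<lambda>x. ((\<Sum>k=1..d. lam k * f k (\<theta> j) / f k x) -
    (\<Sum>k\<in>B. of_nat 1 * f k (\<theta> j) / f k x)) * monomial B (\<lambda>_. 1) x)"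
  define h where "h = (\<lambda>x. \<Sum>k\<in>{1..d} - B. (lam k * f k (\<theta> j)) * monomial (insert k B) (\<lambda>_. 1) x)"
  have "g \<in> generated"
    unfolding g_def using B(1) by (intro generated_derivation_monomial generated_reduced_monomial)
  moreover have "h \<in> generated"
    unfolding h_def using B(1)
    by (intro generated_sum generated_scale generated_reduced_monomial) auto
  ultimately have "(\<lambda>x. inverse (lam j - 1) * (g x - h x)) \<in> generated"
    by (intro generated_scale generated_diff)
  then show ?thesis
  proof (rule generated_cong)
    fix x assume x: "x \<notin> divisor d f"
    define u where "u = monomial B (\<lambda>_. 1) x"
    have fj: "f j x \<noteq> 0" using x j B(1) nonzero_off_divisor by blast
    have on_B: "(\<Sum>k\<in>B. a k * f k (\<theta> j) / f k x) = a j / f j x" for a :: "nat \<Rightarrow> complex"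
    proof -
      have "(\<Sum>k\<in>B. a k * f k (\<theta> j) / f k x) = (\<Sum>k\<in>B. if k = j then a j / f j x else 0)"
        using \<theta> j by (intro sum.cong) (auto simp: dual_def)
      then show ?thesis using fin j by simp
    qed
    have "(\<Sum>k=1..d. lam k * f k (\<theta> j) / f k x) =
        (\<Sum>k\<in>{1..d} - B. lam k * f k (\<theta> j) / f k x) + lam j / f j x"
      using sum.subset_diff[OF B(1), of "\<lambda>k. lam k * f k (\<theta> j) / f k x"] on_B[of lam] by simp
    moreover have "(\<Sum>k\<in>B. of_nat 1 * f k (\<theta> j) / f k x) = 1 / f j x"
      using on_B[of "\<lambda>_. 1"] by simp
    moreover have "h x = (\<Sum>k\<in>{1..d} - B. lam k * f k (\<theta> j) / f k x) * u"
      unfolding h_def u_def sum_distrib_right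
      using fin by (intro sum.cong) (auto simp: monomial_insert field_simps)
    ultimately have "g x - h x = (lam j - 1) * (u / f j x)"
      unfolding g_def u_def[symmetric] by (simp add: algebra_simps diff_divide_distrib)
    moreover have "monomial B p x = u / f j x"
      unfolding u_def
    proof (subst (1 2) monomial_remove[OF fin j(1)])
      have "monomial (B - {j}) p = monomial (B - {j}) (\<lambda>_. 1)"
        using p by (intro monomial_cong) auto
      then show "inverse (f j x) ^ p j * monomial (B - {j}) p x =
          inverse (f j x) ^ 1 * monomial (B - {j}) (\<lambda>_. 1) x / f j x"
        using j(2) by (simp add: power2_eq_square field_simps)
    qed
    ultimately show "inverse (lam j - 1) * (g x - h x) = monomial B p x"
      using lam by simp
  qed
qed

text \<open>Modulo \<open>generated\<close>, the Euler field along the forms with a multiple pole, taken dual to the basis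
  \<open>S \<union> I\<close>, sends \<open>f\<^bsup>-p\<^esup>\<close> to a combination of the fractions obtained by exchanging one
  simple pole. Forms outside the flat of \<open>S \<union> I\<close> contribute fractions of smaller excess.\<close>

lemma exchange_relation:
  assumes lower: "\<And>B p. B \<subseteq> {1..d} \<Longrightarrow> indep B \<Longrightarrow> (\<And>k. k \<in> B \<Longrightarrow> p k \<ge> 1) \<Longrightarrow>
      Suc (\<Sum>k\<in>B. p k - 1) = e \<Longrightarrow> monomial B p \<in> generated"
    and SI: "S \<union> I \<subseteq> {1..d}" "I \<inter> S = {}" "dual (S \<union> I) \<theta>"
    and q: "\<And>k. k \<in> S \<Longrightarrow> q k \<ge> 2" "\<And>k. k \<notin> S \<Longrightarrow> q k = 1" "(\<Sum>k\<in>S. q k - 1) = e"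
  shows "(\<lambda>x. ((\<Sum>k\<in>flat (S \<union> I). lam k) - of_nat e) * monomial (S \<union> I) q x -
    (\<Sum>i\<in>I. \<Sum>k\<in>flat (S \<union> I). lam k * f k (\<theta> i) * monomial (S \<union> insert k (I - {i})) q x)) \<in> generated"
proof -
  define B E where "B = S \<union> I" and "E = flat (S \<union> I)"
  have B: "B \<subseteq> {1..d}" "dual B \<theta>" using SI by (auto simp: B_def)
  have finB: "finite B" using B(1) finite_subset by blast
  then have finS: "finite S" and finI: "finite I" by (auto simp: B_def)
  have indep: "indep B" using B(2) indep_def by blast
  have EA: "E \<subseteq> {1..d}" unfolding E_def by (rule flat_subset)
  have BE: "B \<subseteq> E" unfolding E_def B_def using SI(1) by (rule subset_flat)
  \<comment> \<open>Lowering one multiple pole keeps every exponent at least 1 and brings the excess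
    to \<open>e - 1\<close>, where \<open>lower\<close> applies.\<close>
  define r where "r = (\<lambda>j. q(j := q j - 1))"
  have r1: "r j k \<ge> 1" if "j \<in> S" for j k
    using q(1)[OF that] q(1)[of k] q(2)[of k] by (cases "k \<in> S") (auto simp: r_def)
  have excess_r: "Suc (\<Sum>k\<in>C. r j k - 1) = e" if j: "j \<in> S" and C: "S \<subseteq> C" "finite C" for j C
  proof -
    have "(\<Sum>k\<in>C. r j k - 1) = (\<Sum>k\<in>S. r j k - 1)"
      using C j q(2) by (intro sum.mono_neutral_right) (auto simp: r_def)
    also have "\<dots> = (r j j - 1) + (\<Sum>k\<in>S - {j}. r j k - 1)"
      using finS j by (rule sum.remove)
    also have "(\<Sum>k\<in>S - {j}. r j k - 1) = (\<Sum>k\<in>S - {j}. q k - 1)"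
      by (intro sum.cong) (auto simp: r_def)
    finally show ?thesis
      using sum.remove[OF finS j, of "\<lambda>k. q k - 1"] q(1)[OF j] q(3) by (simp add: r_def)
  qed
  have lowered: "monomial C (r j) x = f j x * monomial C q x"
    if "j \<in> S" "S \<subseteq> C" "finite C" "x \<notin> divisor d f" for j C x
    unfolding r_def using that q(1)[of j] SI(1) nonzero_off_divisor
    by (intro monomial_lower) auto
  \<comment> \<open>The derivative along \<open>\<theta> j\<close> is taken after multiplication by
    \<open>f j\<close>. In this order \<open>j\<close> contributes \<open>q j - 1\<close> instead of
    \<open>q j\<close>, and these numbers add up to the excess \<open>e\<close>.\<close>
  define g where "g = (\<lambda>j x. ((\<Sum>k=1..d. lam k * f k (\<theta> j) / f k x) -
    (\<Sum>k\<in>B. of_nat (r j k) * f k (\<theta> j) / f k x)) * monomial B (r j) x)"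
  have g: "g j \<in> generated" if "j \<in> S" for j
    unfolding g_def using B(1) indep r1[OF that] excess_r[OF that _ finB]
    by (intro generated_derivation_monomial lower) (auto simp: B_def)
  define h where "h = (\<lambda>x. \<Sum>k\<in>{1..d} - E. \<Sum>j\<in>S. (lam k * f k (\<theta> j)) * monomial (insert k B) (r j) x)"
  have "h \<in> generated"
    unfolding h_def
  proof (intro generated_sum generated_scale)
    fix k j assume k: "k \<in> {1..d} - E" and j: "j \<in> S"
    have "indep (insert k B)"
      using k B(1) indep unfolding E_def B_def by (intro indep_insert) auto
    then show "monomial (insert k B) (r j) \<in> generated"
      using k B(1) r1[OF j] excess_r[OF j, of "insert k B"] finB
      by (intro lower) (auto simp: B_def)
  qed
  then have "(\<lambda>x. (\<Sum>j\<in>S. g j x) - h x) \<in> generated"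
    using g by (intro generated_diff generated_sum)
  then show ?thesis
  proof (rule generated_cong)
    fix x assume x: "x \<notin> divisor d f"
    define u where "u = monomial B q x"
    have nz: "f k x \<noteq> 0" if "k \<in> {1..d}" for k using x that by (rule nonzero_off_divisor)
    have gj: "g j x = (\<Sum>k=1..d. lam k * f k (\<theta> j) * f j x / f k x) * u - of_nat (q j - 1) * u"
      if j: "j \<in> S" for j
    proof -
      have "(\<Sum>k\<in>B. of_nat (r j k) * f k (\<theta> j) / f k x) =
          (\<Sum>k\<in>B. if k = j then of_nat (q j - 1) / f j x else 0)"
        using B(2) j by (intro sum.cong) (auto simp: dual_def B_def r_def)
      also have "\<dots> = of_nat (q j - 1) / f j x"
        using finB j by (simp add: B_def)
      finally have *: "(\<Sum>k\<in>B. of_nat (r j k) * f k (\<theta> j) / f k x) = of_nat (q j - 1) / f j x" .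
      have **: "monomial B (r j) x = f j x * u"
        unfolding u_def using j x finB by (intro lowered) (auto simp: B_def)
      have "j \<in> {1..d}" using j SI(1) by blast
      moreover have "(\<Sum>k=1..d. lam k * f k (\<theta> j) * f j x / f k x) =
          (\<Sum>k=1..d. lam k * f k (\<theta> j) / f k x) * f j x"
        by (simp add: sum_distrib_right)
      ultimately show ?thesis
        unfolding g_def * ** using nz[of j] by (simp add: field_simps)
    qed
    define a where "a = (\<lambda>k. lam k * (\<Sum>j\<in>S. f k (\<theta> j) * f j x) / f k x * u)"
    have "(\<Sum>j\<in>S. g j x) = (\<Sum>k=1..d. a k) - (\<Sum>j\<in>S. of_nat (q j - 1)) * u"
    proof -
      have "(\<Sum>j\<in>S. (\<Sum>k=1..d. lam k * f k (\<theta> j) * f j x / f k x) * u) = (\<Sum>k=1..d. a k)"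
        unfolding a_def sum_distrib_right sum_distrib_left sum_divide_distrib
        by (subst sum.swap) (simp add: mult_ac)
      then show ?thesis by (simp add: gj sum_subtractf sum_distrib_right)
    qed
    also have "(\<Sum>j\<in>S. of_nat (q j - 1)) = (of_nat e :: complex)"
      unfolding q(3)[symmetric] by (rule of_nat_sum[symmetric])
    also have "(\<Sum>k=1..d. a k) = h x + (\<Sum>k\<in>E. a k)"
    proof -
      have "h x = (\<Sum>k\<in>{1..d} - E. a k)"
        unfolding h_def
      proof (intro sum.cong refl)
        fix k assume k: "k \<in> {1..d} - E"
        have kB: "k \<notin> B" "q k = 1" using k BE q(2)[of k] by (auto simp: B_def)
        have "monomial (insert k B) (r j) x = f j x * (u / f k x)" if "j \<in> S" for j
          using lowered[OF that _ _ x, of "insert k B"] finB kB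
          by (auto simp: B_def monomial_insert u_def field_simps)
        then show "(\<Sum>j\<in>S. lam k * f k (\<theta> j) * monomial (insert k B) (r j) x) = a k"
          by (simp add: a_def sum_distrib_left sum_distrib_right sum_divide_distrib mult_ac)
      qed
      then show ?thesis using sum.subset_diff[OF EA, of a] by simp
    qed
    \<comment> \<open>Expanding \<open>f k\<close> in the basis \<open>S \<union> I\<close>, its
      part over \<open>S\<close> is \<open>f k\<close> minus its part over \<open>I\<close>. The
      first gives the weight \<open>lam k\<close>, the second the exchange terms.\<close>
    also have "(\<Sum>k\<in>E. a k) = (\<Sum>k\<in>E. lam k * u -
        (\<Sum>i\<in>I. lam k * f k (\<theta> i) * monomial (S \<union> insert k (I - {i})) q x))"
    proof (intro sum.cong refl)
      fix k assume k: "k \<in> E"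
      then have kA: "k \<in> {1..d}" using EA by blast
      have "f k x = (\<Sum>i\<in>B. f k (\<theta> i) * f i x)"
        using flat_expand[OF B] k unfolding E_def B_def by blast
      also have "\<dots> = (\<Sum>i\<in>S. f k (\<theta> i) * f i x) + (\<Sum>i\<in>I. f k (\<theta> i) * f i x)"
        unfolding B_def using finS finI SI(2) by (intro sum.union_disjoint) auto
      finally have "a k = lam k * ((f k x - (\<Sum>i\<in>I. f k (\<theta> i) * f i x)) / f k x) * u"
        by (simp add: a_def)
      also have "\<dots> = lam k * u - lam k * (\<Sum>i\<in>I. f k (\<theta> i) * f i x) / f k x * u"
        using nz[OF kA] by (simp add: field_simps)
      also have "lam k * (\<Sum>i\<in>I. f k (\<theta> i) * f i x) / f k x * u =
          (\<Sum>i\<in>I. lam k * f k (\<theta> i) * (f i x / f k x * u))"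
        by (simp add: sum_distrib_left sum_distrib_right sum_divide_distrib mult_ac)
      also have "\<dots> = (\<Sum>i\<in>I. lam k * f k (\<theta> i) * monomial (S \<union> insert k (I - {i})) q x)"
      proof (intro sum.cong refl)
        fix i assume i: "i \<in> I"
        show "lam k * f k (\<theta> i) * (f i x / f k x * u) =
            lam k * f k (\<theta> i) * monomial (S \<union> insert k (I - {i})) q x"
        \<comment> \<open>If the coefficient is nonzero, duality forces
          \<open>k \<notin> B - {i}\<close>, so \<open>f i x / f k x\<close> really exchanges the
          simple pole at \<open>i\<close> for one at \<open>k\<close>; \<open>k = i\<close> is
          allowed.\<close>
        proof (cases "f k (\<theta> i) = 0")
          case False
          have iS: "i \<notin> S" using i SI(2) by blast
          have "k \<notin> B - {i}"
            using False B(2) i by (auto simp: dual_def B_def)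
          moreover have "S \<union> insert k (I - {i}) = insert k (B - {i})"
            using iS by (auto simp: B_def)
          moreover have "q k = 1"
            using \<open>k \<notin> B - {i}\<close> iS by (intro q(2)) (auto simp: B_def)
          moreover have "u = inverse (f i x) * monomial (B - {i}) q x"
            unfolding u_def using monomial_remove[OF finB, of i q x] i q(2)[OF iS] by (simp add: B_def)
          moreover have "f i x \<noteq> 0" using i SI(1) nz by blast
          ultimately show ?thesis
            using finB by (simp add: monomial_insert field_simps)
        qed simp
      qed
      finally show "a k = lam k * u -
          (\<Sum>i\<in>I. lam k * f k (\<theta> i) * monomial (S \<union> insert k (I - {i})) q x)" .
    qed
    also have "\<dots> = (\<Sum>k\<in>E. lam k) * u -
        (\<Sum>i\<in>I. \<Sum>k\<in>E. lam k * f k (\<theta> i) * monomial (S \<union> insert k (I - {i})) q x)"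
      unfolding sum_subtractf sum_distrib_right by (subst sum.swap) (rule refl)
    finally show "(\<Sum>j\<in>S. g j x) - h x = ((\<Sum>k\<in>flat (S \<union> I). lam k) - of_nat e) * monomial (S \<union> I) q x -
        (\<Sum>i\<in>I. \<Sum>k\<in>flat (S \<union> I). lam k * f k (\<theta> i) * monomial (S \<union> insert k (I - {i})) q x)"
      unfolding E_def[symmetric] unfolding B_def[symmetric] u_def[symmetric]
      by (simp add: algebra_simps)
  qed
qed

text \<open>In the main case a functional vanishing on \<open>generated\<close> but not on the given
  fraction would turn the exchange relations into a residue system with a nonzero solution.\<close>

lemma generated_indep_monomial:
  assumes lam1: "\<And>j. j \<in> {1..d} \<Longrightarrow> lam j \<noteq> 1"
    and lam: "\<And>C e. C \<subseteq> {1..d} \<Longrightarrow> C \<noteq> {} \<Longrightarrow> e \<ge> 2 \<Longrightarrow> (\<Sum>k\<in>flat C. lam k) \<noteq> of_nat e"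
    and B: "B \<subseteq> {1..d}" "indep B" and p: "\<And>k. k \<in> B \<Longrightarrow> p k \<ge> 1"
  shows "monomial B p \<in> generated"
  using B p
proof (induction "\<Sum>k\<in>B. p k - 1" arbitrary: B p rule: less_induct)
  case less
  note B = less.prems(1,2) and p = less.prems(3)
  define e where "e = (\<Sum>k\<in>B. p k - 1)"
  have finB: "finite B" using B(1) finite_subset by blast
  define S where "S = {k\<in>B. p k \<ge> 2}"
  have SB: "S \<subseteq> B" by (auto simp: S_def)
  have finS: "finite S" using SB finB by (rule finite_subset)
  have eS: "(\<Sum>k\<in>S. p k - 1) = e"
    unfolding e_def S_def using finB by (intro sum.mono_neutral_left) auto
  have p1: "p k = 1" if "k \<in> B - S" for k
    using that p[of k] by (auto simp: S_def)
  show ?case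
  proof (cases "S = {}")
    case True
    then have "monomial B p = monomial B (\<lambda>_. 1)" using p1 by (intro monomial_cong) auto
    then show ?thesis using generated_reduced_monomial[OF B(1)] by simp
  next
    case False
    then obtain j where j: "j \<in> S" by blast
    have e_split: "e = (p j - 1) + (\<Sum>k\<in>S - {j}. p k - 1)"
      unfolding eS[symmetric] using finS j by (rule sum.remove)
    show ?thesis
    proof (cases "e = 1")
      case True
      have "(\<Sum>k\<in>S - {j}. p k - 1) = 0" and pj: "p j = 2"
        using e_split True j by (auto simp: S_def)
      then have "S - {j} = {}" using finS by (auto simp: S_def)
      then show ?thesis
        using B j SB pj p1 lam1 by (intro generated_excess_one[of B j]) auto
    next
      case False
      then have e2: "e \<ge> 2" using e_split j by (auto simp: S_def)
      \<comment> \<open>Exponent 1 outside \<open>S\<close> lets the same \<open>q\<close> describe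
        all fractions obtained by varying the simple poles.\<close>
      define q where "q = (\<lambda>k. if k \<in> S then p k else 1)"
      have Bq: "monomial B p = monomial B q"
        using p1 by (intro monomial_cong) (auto simp: q_def)
      show ?thesis
      proof (rule ccontr)
        assume "monomial B p \<notin> generated"
        show False
        proof (rule exists_annihilating_functional[OF generated_add generated_scale generated_zero
              \<open>monomial B p \<notin> generated\<close>])
          fix L :: "(complex ^ 'n \<Rightarrow> complex) \<Rightarrow> complex"
          assume L_add: "\<And>g h. L (\<lambda>x. g x + h x) = L g + L h"
            and L_scale: "\<And>c h. L (\<lambda>x. c * h x) = c * L h"
            and L_gen: "\<And>h. h \<in> generated \<Longrightarrow> L h = 0"
            and L_B: "L (monomial B p) \<noteq> 0"
          have L_sum: "L (\<lambda>x. \<Sum>i\<in>X. h i x) = (\<Sum>i\<in>X. L (h i))" for X :: "nat set" and h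
            using L_scale[of 0 "\<lambda>x. 0"]
            by (induction X rule: infinite_finite_induct) (simp_all add: L_add)
          have L_diff: "L (\<lambda>x. g x - h x) = L g - L h" for g h
            using L_add[of g "\<lambda>x. -1 * h x"] L_scale[of "-1" h] by simp
          define \<phi> where "\<phi> = (\<lambda>I. L (monomial (S \<union> I) q))"
          have "\<phi> (B - S) = 0"
          proof (rule residue_system_trivial[of S lam "of_nat e"])
            show "S \<subseteq> {1..d}" "B - S \<subseteq> {1..d}" using SB B(1) by auto
            show "(B - S) \<inter> S = {}" by blast
            have "S \<union> (B - S) = B" using SB by blast
            then show "indep (S \<union> (B - S))" using B(2) by simp
            show "(\<Sum>k\<in>flat C. lam k) \<noteq> of_nat e" if "S \<subseteq> C" "C \<subseteq> {1..d}" for C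
              using that j e2 by (intro lam) auto
          next
            fix I \<theta>
            assume I: "I \<subseteq> {1..d}" "I \<inter> S = {}" "flat (S \<union> I) = flat (S \<union> (B - S))" "dual (S \<union> I) \<theta>"
            have "L (\<lambda>x. ((\<Sum>k\<in>flat (S \<union> I). lam k) - of_nat e) * monomial (S \<union> I) q x -
                (\<Sum>i\<in>I. \<Sum>k\<in>flat (S \<union> I). lam k * f k (\<theta> i) * monomial (S \<union> insert k (I - {i})) q x)) = 0"
            proof (rule L_gen, rule exchange_relation)
              show "monomial C r \<in> generated"
                if "C \<subseteq> {1..d}" "indep C" "\<And>k. k \<in> C \<Longrightarrow> r k \<ge> 1" "Suc (\<Sum>k\<in>C. r k - 1) = e" for C r
                using that unfolding e_def by (intro less.hyps) auto
              show "S \<union> I \<subseteq> {1..d}" using SB B(1) I(1) by blast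
              show "(\<Sum>k\<in>S. q k - 1) = e" unfolding eS[symmetric] by (simp add: q_def)
            qed (use I in \<open>auto simp: q_def S_def\<close>)
            then show "((\<Sum>k\<in>flat (S \<union> (B - S)). lam k) - of_nat e) * \<phi> I =
                (\<Sum>i\<in>I. \<Sum>k\<in>flat (S \<union> (B - S)). lam k * f k (\<theta> i) * \<phi> (insert k (I - {i})))"
              unfolding L_diff L_sum L_scale \<phi>_def I(3) by simp
          qed
          moreover have "S \<union> (B - S) = B" using SB by blast
          ultimately show False using L_B by (simp add: \<phi>_def Bq)
        qed
      qed
    qed
  qed
qed

text \<open>If the forms with positive exponent are dependent, a form \<open>f\<^sub>l\<close> is a combination of forms with
  smaller index, and expanding \<open>f\<^sub>l / f\<^sub>l\<close> moves pole order to the larger index \<open>l\<close>.\<close>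

lemma generated_monomial:
  assumes indep: "\<And>B p. B \<subseteq> {1..d} \<Longrightarrow> indep B \<Longrightarrow> (\<And>k. k \<in> B \<Longrightarrow> p k \<ge> 1) \<Longrightarrow>
      monomial B p \<in> generated"
  shows "monomial {1..d} p \<in> generated"
\<comment> \<open>The weight \<open>d - k\<close> falls as the index grows, so moving pole order to
  a larger index lowers the measure.\<close>
proof (induction "\<Sum>k=1..d. (d - k) * p k" arbitrary: p rule: less_induct)
  case less
  define B where "B = {k\<in>{1..d}. p k \<noteq> 0}"
  have B: "B \<subseteq> {1..d}" by (auto simp: B_def)
  show ?case
  proof (cases "indep B")
    case True
    have "monomial B p \<in> generated" by (rule indep[OF B True]) (simp add: B_def)
    moreover have "monomial B p x = monomial {1..d} p x" for x
      unfolding monomial_def using B by (intro prod.mono_neutral_left) (auto simp: B_def)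
    ultimately show ?thesis by (rule generated_cong)
  next
    case False
    then obtain l where l: "l \<in> B" "indep (B \<inter> {..<l})" "l \<in> flat (B \<inter> {..<l})"
      using indep_or_dependent_on_smaller[OF B] by blast
    define C where "C = B \<inter> {..<l}"
    have C: "C \<subseteq> {1..d}" using B by (auto simp: C_def)
    obtain \<theta> where \<theta>: "dual C \<theta>" using l(2) unfolding indep_def C_def by blast
    define q where "q = (\<lambda>k. (p(k := p k - 1))(l := p l + 1))"
    have "monomial {1..d} (q k) \<in> generated" if k: "k \<in> C" for k
    proof (rule less.hyps)
      have kl: "k \<in> {1..d}" "l \<in> {1..d}" "k < l" "p k \<ge> 1"
        using k l(1) by (auto simp: C_def B_def)
      have split: "(\<Sum>i=1..d. (d - i) * r i) =
          (d - k) * r k + ((d - l) * r l + (\<Sum>i\<in>{1..d} - {k} - {l}. (d - i) * r i))"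
        for r :: "nat \<Rightarrow> nat"
      proof -
        have "(\<Sum>i=1..d. (d - i) * r i) = (d - k) * r k + (\<Sum>i\<in>{1..d} - {k}. (d - i) * r i)"
          using kl by (intro sum.remove) auto
        also have "(\<Sum>i\<in>{1..d} - {k}. (d - i) * r i) =
            (d - l) * r l + (\<Sum>i\<in>{1..d} - {k} - {l}. (d - i) * r i)"
          using kl by (intro sum.remove) auto
        finally show ?thesis .
      qed
      have rest: "(\<Sum>i\<in>{1..d} - {k} - {l}. (d - i) * q k i) =
          (\<Sum>i\<in>{1..d} - {k} - {l}. (d - i) * p i)"
        by (intro sum.cong) (auto simp: q_def)
      obtain m where m: "p k = Suc m" using kl(4) by (cases "p k") auto
      have "d - l < d - k" using kl by auto
      then show "(\<Sum>i=1..d. (d - i) * q k i) < (\<Sum>i=1..d. (d - i) * p i)"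
        unfolding split rest using kl(3) m by (simp add: q_def)
    qed
    then have "(\<lambda>x. \<Sum>k\<in>C. f l (\<theta> k) * monomial {1..d} (q k) x) \<in> generated"
      by (intro generated_sum generated_scale)
    then show ?thesis
    proof (rule generated_cong)
      fix x assume x: "x \<notin> divisor d f"
      have lA: "l \<in> {1..d}" using l(1) B by blast
      have fl: "f l x \<noteq> 0" using x lA by (rule nonzero_off_divisor)
      have "monomial {1..d} (q k) x = f k x * monomial {1..d} p x / f l x" if k: "k \<in> C" for k
      proof -
        have kl: "k \<in> {1..d}" "k \<noteq> l" "p k \<ge> 1" using k by (auto simp: C_def B_def)
        have "monomial {1..d} (q k) x =
            inverse (f l x) * monomial {1..d} (p(k := p k - 1)) x"
        proof -
          have "monomial ({1..d} - {l}) (q k) = monomial ({1..d} - {l}) (p(k := p k - 1))"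
            by (rule monomial_cong) (auto simp: q_def)
          then show ?thesis
            using kl(2) monomial_remove[OF _ lA, of "q k" x]
              monomial_remove[OF _ lA, of "p(k := p k - 1)" x]
            by (simp add: q_def)
        qed
        also have "monomial {1..d} (p(k := p k - 1)) x = f k x * monomial {1..d} p x"
          using kl x by (intro monomial_lower nonzero_off_divisor) auto
        finally show ?thesis by (simp add: field_simps)
      qed
      then have "(\<Sum>k\<in>C. f l (\<theta> k) * monomial {1..d} (q k) x) =
          (\<Sum>k\<in>C. f l (\<theta> k) * f k x) * (monomial {1..d} p x / f l x)"
        unfolding sum_distrib_right by (intro sum.cong) auto
      also have "(\<Sum>k\<in>C. f l (\<theta> k) * f k x) = f l x"
        using flat_expand[OF C \<theta> l(3)[folded C_def], of x] by (rule sym)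
      finally show "(\<Sum>k\<in>C. f l (\<theta> k) * monomial {1..d} (q k) x) = monomial {1..d} p x"
        using fl by simp
    qed
  qed
qed

section \<open>From global fractions to sheaves of modules\<close>

lemma shifted_power_eq_monomial: "shifted_power d f (\<lambda>k. int (p k)) = monomial {1..d} p"
  by (simp add: fun_eq_iff shifted_power_def monomial_def power_int_minus power_inverse)

text \<open>A local operator is composed with the restriction of a global one producing the
  fraction. That fraction is known only off the divisor, so locality on an open set is used.\<close>

lemma star_module_subset_cyclic_module:
  assumes "\<And>p. monomial {1..d} p \<in> generated"
  shows "star_module d f lam U \<subseteq> cyclic_module d f lam (shifted_power d f (\<lambda>k. 1)) U"
proof
  fix h assume h: "h \<in> star_module d f lam U"
  show "h \<in> cyclic_module d f lam (shifted_power d f (\<lambda>k. 1)) U"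
    unfolding cyclic_module_def
  proof (intro CollectI ballI)
    fix x assume "x \<in> U"
    then obtain V p where V: "x \<in> V" "V \<subseteq> U"
      and hV: "h \<in> cyclic_module d f lam (shifted_power d f (\<lambda>k. int (p k))) V"
      using h unfolding star_module_def by blast
    obtain W P Q where W: "open W" "x \<in> W" "W \<subseteq> V" and Q: "acts_as d f lam W P Q"
      and hQ: "\<forall>y\<in>W - divisor d f. h y = Q (monomial {1..d} p) y"
      using hV V(1) unfolding cyclic_module_def shifted_power_eq_monomial by blast
    obtain P' Q' where Q': "acts_as d f lam UNIV P' Q'"
      and mQ': "\<forall>y. y \<notin> divisor d f \<longrightarrow> monomial {1..d} p y = Q' (shifted_power d f (\<lambda>k. 1)) y"
      using assms[of p] unfolding generated_def by blast
    have act: "acts_as d f lam W (P \<circ> P') (Q \<circ> Q')"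
      using Q acts_as_subset[OF Q' subset_UNIV] by (rule acts_as.comp)
    have "open (W - divisor d f)"
      using W(1) open_Compl_divisor by (simp add: Diff_eq open_Int)
    from acts_as_cong_open[OF Q this, of "monomial {1..d} p" "Q' (shifted_power d f (\<lambda>k. 1))"]
    have "\<forall>y\<in>W - divisor d f. h y = (Q \<circ> Q') (shifted_power d f (\<lambda>k. 1)) y"
      using hQ mQ' by simp
    moreover have "P \<circ> P' \<in> diff_ops W"
      using act unfolding diff_ops_iff_acts_as[of _ W d f lam] by blast
    ultimately show "\<exists>V. open V \<and> x \<in> V \<and> V \<subseteq> U \<and>
        (\<exists>P\<in>diff_ops V. \<exists>Q. acts_as d f lam V P Q \<and>
          (\<forall>y\<in>V - divisor d f. h y = Q (shifted_power d f (\<lambda>k. 1)) y))"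
      using W V(2) act by blast
  qed
qed

end

text \<open>A hyperplane and one vector outside it span the space. This bound makes the hypothesis
  on a single hyperplane exclude the weight 1.\<close>

lemma edge_rank_hyperplane_le:
  fixes f :: "nat \<Rightarrow> complex ^ 'n \<Rightarrow> complex"
  assumes "Vector_Spaces.linear (*s) (*) (f j)"
  shows "edge_rank (hyperplane f j) \<le> 1"
proof (cases "\<exists>v. f j v \<noteq> 0")
  case True
  then obtain v where v: "f j v \<noteq> 0" by blast
  interpret g: Vector_Spaces.linear "(*s)" "(*)" "f j" by fact
  have "x \<in> vec.span (insert v (hyperplane f j))" for x
  proof -
    have "f j (x - (f j x / f j v) *s v) = 0" using v by (simp add: g.diff g.scale)
    then have "x - (f j x / f j v) *s v \<in> vec.span (insert v (hyperplane f j))"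
      by (intro vec.span_base) (simp add: hyperplane_def)
    moreover have "(f j x / f j v) *s v \<in> vec.span (insert v (hyperplane f j))"
      by (intro vec.span_scale vec.span_base) simp
    ultimately show ?thesis by (metis diff_add_cancel vec.span_add)
  qed
  then have "vec.dim (insert v (hyperplane f j)) = vec.dim (UNIV :: (complex ^ 'n) set)"
    by (metis UNIV_eq_I vec.dim_span)
  then have "CARD('n) \<le> vec.dim (hyperplane f j) + 1"
    using vec.dim_insert[of v "hyperplane f j"] by (simp add: card_cart_basis split: if_splits)
  then show ?thesis by (simp add: edge_rank_def)
next
  case False
  then have "hyperplane f j = UNIV" by (auto simp: hyperplane_def)
  then show ?thesis by (simp add: edge_rank_def card_cart_basis)
qed

theorem theorem1p8:
  fixes d :: nat
    and f :: "nat \<Rightarrow> complex ^ 'n \<Rightarrow> complex"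
    and lam :: "nat \<Rightarrow> complex"
  assumes "reduced_central_arrangement d f"
    and "\<And>E. E \<in> edges d f \<Longrightarrow>
      (\<Sum>k\<in>{k\<in>{1..d}. E \<subseteq> hyperplane f k}. lam k) \<notin> of_int ` {int (min 2 (edge_rank E))..}"
  shows "\<forall>U. open U \<longrightarrow>
      cyclic_module d f lam (shifted_power d f (\<lambda>k. 1)) U = star_module d f lam U"
proof (intro allI impI)
  fix U :: "(complex ^ 'n) set"
  assume U: "open U"
  have lin: "Vector_Spaces.linear (*s) (*) (f k)" and nz: "\<exists>x. f k x \<noteq> 0" if "k \<in> {1..d}" for k
    using assms(1) that unfolding reduced_central_arrangement_def by auto
  interpret twisted_arrangement d f lam
    by (intro twisted_arrangement.intro linear_forms.intro lin finite_atLeastAtMost)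
  have weights: "(\<Sum>k\<in>flat C. lam k) \<notin> of_int ` {int (min 2 (edge_rank (\<Inter>k\<in>C. hyperplane f k)))..}"
    if "C \<subseteq> {1..d}" "C \<noteq> {}" for C
  proof -
    have "(\<Inter>k\<in>C. hyperplane f k) \<in> edges d f"
      using that unfolding edges_def by blast
    from assms(2)[OF this] show ?thesis unfolding flat_eq_hyperplanes .
  qed
  have higher: "(\<Sum>k\<in>flat C. lam k) \<noteq> of_nat e" if "C \<subseteq> {1..d}" "C \<noteq> {}" "e \<ge> 2" for C e
  proof
    assume "(\<Sum>k\<in>flat C. lam k) = of_nat e"
    then have "(\<Sum>k\<in>flat C. lam k) = of_int (int e)" by simp
    moreover have "int e \<in> {int (min 2 (edge_rank (\<Inter>k\<in>C. hyperplane f k)))..}"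
      using that(3) by simp
    ultimately show False using weights[OF that(1,2)] by blast
  qed
  have first: "lam j \<noteq> 1" if j: "j \<in> {1..d}" for j
  proof
    assume lam: "lam j = 1"
    obtain v where v: "f j v \<noteq> 0" using nz[OF j] by blast
    \<comment> \<open>A nonzero form vanishing where \<open>f j\<close> does is a multiple of
      \<open>f j\<close>, so it has the same hyperplane; distinctness gives
      \<open>k = j\<close>.\<close>
    have "k = j" if k: "k \<in> flat {j}" for k
    proof -
      have kA: "k \<in> {1..d}" using k flat_subset by blast
      have scaled: "f k x = f j x / f j v * f k v" for x
        using flat_eval[OF k, of "x - (f j x / f j v) *s v"] v j kA
        by (simp add: form_diff form_scale)
      then have fkv: "f k v \<noteq> 0" using nz[OF kA] by fastforce
      have "f k x = 0 \<longleftrightarrow> f j x = 0" for x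
        unfolding scaled[of x] using v fkv by simp
      then have "hyperplane f k = hyperplane f j" by (simp add: hyperplane_def)
      then show ?thesis
        using assms(1) kA j unfolding reduced_central_arrangement_def inj_on_def by blast
    qed
    then have "flat {j} = {j}" using subset_flat[of "{j}"] j by blast
    then have "(\<Sum>k\<in>flat {j}. lam k) = of_int 1" using lam by simp
    moreover have "(1::int) \<in> {int (min 2 (edge_rank (\<Inter>k\<in>{j}. hyperplane f k)))..}"
      using edge_rank_hyperplane_le[of f j] lin[OF j] by simp
    ultimately show False using weights[of "{j}"] j by blast
  qed
  have "monomial {1..d} p \<in> generated" for p
    by (rule generated_monomial, rule generated_indep_monomial[OF first higher])
  then have "star_module d f lam U \<subseteq> cyclic_module d f lam (shifted_power d f (\<lambda>k. 1)) U"
    by (rule star_module_subset_cyclic_module)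
  \<comment> \<open>The generator is itself one of the shifted powers, with all exponents
    \<open>p k = 1\<close>.\<close>
  moreover have "cyclic_module d f lam (shifted_power d f (\<lambda>k. 1)) U \<subseteq> star_module d f lam U"
    unfolding star_module_def using U by (auto intro!: exI[of _ U] exI[of _ "\<lambda>_. 1"])
  ultimately show "cyclic_module d f lam (shifted_power d f (\<lambda>k. 1)) U = star_module d f lam U"
    by blast
qed

end
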